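(* Let $T$ be a propositional theory over $\mathcal V$, let $(\mathcal A,\oplus,\otimes,e^\oplus,e^\otimes)$ be a commutative semiring, and let $\alpha:\mathcal L\to\mathcal A$ be a labeling function on the literals of $\mathcal V$. If $N_T$ is an sd-DNNF representation of $T$ (i.e. an NNF circuit over $\mathcal V$ that is smooth, deterministic and decomposable and that represents $T$), then evaluating $N_T$ is a sound AMC (algebraic model counting) computation, i.e. $$\mathrm{Eval}(N_T,\oplus,\otimes,e^\oplus,e^\otimes,\alpha)=\mathbf A(T).$$
   Context: A semiring $(\mathcal A,\oplus,\otimes,e^\oplus,e^\otimes)$ has associative binary operations $\oplus,\otimes$ on $\mathcal A$, with $\oplus$ commutative, $\otimes$ distributing over $\oplus$, $e^\oplus\in\mathcal A$ neutral for $\oplus$, $e^\otimes\in\mathcal A$ neutral for $\otimes$, and $e^\oplus\otimes a=a\otimes e^\oplus=e^\oplus$ for all $a\in\mathcal A$. It is commutative if $\otimes$ is also commutative. Algebraic model count: for a propositional theory $T$ over a finite set $\mathcal V$ of variables and $\alpha:\mathcal L\to\mathcal A$ on the set $\mathcal L$ of literals of the variables in $\mathcal V$, $$\mathbf A(T)=\bigoplus_{I\in\mathcal M(T)}\ \bigotimes_{l\in I}\alpha(l),$$ where $\mathcal M(T)$ is the set of models of $T$, each model being given as a set of literals containing exactly one of $v,\neg v$ for each $v\in\mathcal V$. Empty sums are $e^\oplus$, empty products $e^\otimes$. An NNF circuit (sentence in negation normal form) over $\mathcal V$ is a rooted directed acyclic graph whose leaves are labeled with true ($\top$), false ($\bot$)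 or a literal of a variable in $\mathcal V$, and whose internal nodes are labeled with disjunction ($\vee$) or conjunction ($\wedge$). Each node is identified with the formula of the subcircuit rooted at it; a circuit represents $T$ if its root formula is logically equivalent to $T$. The circuit is decomposable if for each conjunction node $\bigwedge_{i=1}^n\phi_i$ no two children $\phi_i,\phi_j$ ($i\ne j$) share any variable; deterministic if for each disjunction node $\bigvee_{i=1}^n\phi_i$ each pair of different children $\phi_i,\phi_j$ is logically inconsistent; smooth if for each disjunction node $\bigvee_{i=1}^n\phi_i$ each child mentions the same set of variables. $\mathrm{Eval}$ is defined recursively: $\top\mapsto e^\otimes$, $\bot\mapsto e^\oplus$, literal $l\mapsto\alpha(l)$, a disjunction node $\mapsto$ the $\oplus$-sum of the values of its children, a conjunction node $\mapsto$ the $\otimes$-product of the values of its children; the value of the circuit is that of its root.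
   Formalization: The formal theorem also assumes that the root of the circuit mentions every variable of V; without this the claim fails, e.g. V={v}, T empty, circuit the single leaf true: its value is the unit, but A(T)=α(v)⊕α(¬v). *)

theory Defs
  imports Main
begin

section \<open>Propositional theories and algebraic model counting\<close>

datatype 'v literal = Pos 'v | Neg 'v

fun var_of :: "'v literal \<Rightarrow> 'v" where
  "var_of (Pos v) = v"
| "var_of (Neg v) = v"

definition literals :: "'v set \<Rightarrow> 'v literal set" where
  "literals V = {l. var_of l \<in> V}"

definition interpretations :: "'v set \<Rightarrow> 'v literal set set" where
  "interpretations V = {I. I \<subseteq> literals V \<and> (\<forall>v\<in>V. (Pos v \<in> I) \<noteq> (Neg v \<in> I))}"

datatype 'v formula =
    FTrue
  | FFalse
  | FAtom 'v
  | FNot "'v formula"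
  | FAnd "'v formula" "'v formula"
  | FOr "'v formula" "'v formula"
  | FImp "'v formula" "'v formula"
  | FIff "'v formula" "'v formula"

fun satisfies :: "'v literal set \<Rightarrow> 'v formula \<Rightarrow> bool" where
  "satisfies I FTrue \<longleftrightarrow> True"
| "satisfies I FFalse \<longleftrightarrow> False"
| "satisfies I (FAtom v) \<longleftrightarrow> Pos v \<in> I"
| "satisfies I (FNot p) \<longleftrightarrow> \<not> satisfies I p"
| "satisfies I (FAnd p q) \<longleftrightarrow> satisfies I p \<and> satisfies I q"
| "satisfies I (FOr p q) \<longleftrightarrow> satisfies I p \<or> satisfies I q"
| "satisfies I (FImp p q) \<longleftrightarrow> (satisfies I p \<longrightarrow> satisfies I q)"
| "satisfies I (FIff p q) \<longleftrightarrow> (satisfies I p \<longleftrightarrow> satisfies I q)"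

text \<open>A theory is a (possibly infinite) set of formulas, read conjunctively.\<close>

definition theory_over :: "'v set \<Rightarrow> 'v formula set \<Rightarrow> bool" where
  "theory_over V T \<longleftrightarrow> (\<forall>p\<in>T. set_formula p \<subseteq> V)"

definition models :: "'v set \<Rightarrow> 'v formula set \<Rightarrow> 'v literal set set" where
  "models V T = {I \<in> interpretations V. \<forall>p\<in>T. satisfies I p}"

text \<open>
  The sort \<open>{comm_semiring_0, comm_monoid_mult}\<close> axiomatizes exactly the commutative semirings
  with neutral elements \<open>0\<close> and \<open>1\<close>. The class \<open>comm_semiring_1\<close> would in addition require
  \<open>0 \<noteq> 1\<close>.
\<close>

definition AMC ::
  "'v set \<Rightarrow> ('v literal \<Rightarrow> 'a::{comm_semiring_0, comm_monoid_mult}) \<Rightarrow> 'v formula set \<Rightarrow> 'a"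
where
  "AMC V \<alpha> T = (\<Sum>I\<in>models V T. \<Prod>l\<in>I. \<alpha> l)"


section \<open>Circuits in negation normal form\<close>

datatype 'v label = LTrue | LFalse | LLit "'v literal" | LOr | LAnd

record ('n, 'v) nnf =
  nodes :: "'n set"
  edges :: "('n \<times> 'n) set"
  root :: 'n
  label :: "'n \<Rightarrow> 'v label"

text \<open>Edges point from a node to its children.\<close>

definition children :: "('n, 'v) nnf \<Rightarrow> 'n \<Rightarrow> 'n set" where
  "children C n = edges C `` {n}"

definition nnf_circuit :: "'v set \<Rightarrow> ('n, 'v) nnf \<Rightarrow> bool" where
  "nnf_circuit V C \<longleftrightarrow>
     finite (nodes C) \<and> edges C \<subseteq> nodes C \<times> nodes C \<and> acyclic (edges C) \<and>
     root C \<in> nodes C \<and> (\<forall>n\<in>nodes C. (root C, n) \<in> (edges C)\<^sup>*) \<and>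
     (\<forall>n\<in>nodes C. children C n = {} \<longrightarrow> label C n \<in> {LTrue, LFalse} \<union> LLit ` literals V) \<and>
     (\<forall>n\<in>nodes C. children C n \<noteq> {} \<longrightarrow> label C n \<in> {LOr, LAnd})"

definition node_vars :: "('n, 'v) nnf \<Rightarrow> 'n \<Rightarrow> 'v set" where
  "node_vars C n = {var_of l | l m. (n, m) \<in> (edges C)\<^sup>* \<and> label C m = LLit l}"

text \<open>
  Truth value and semiring value of a node are defined by well-founded recursion from the leaves
  upwards; the recursion equations are \<open>node_sat_rec\<close> and \<open>node_eval_rec\<close> below.
\<close>

definition node_sat :: "('n, 'v) nnf \<Rightarrow> 'v literal set \<Rightarrow> 'n \<Rightarrow> bool" where
  "node_sat C I = wfrec ((edges C)\<inverse>) (\<lambda>sat n.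
     case label C n of
       LTrue \<Rightarrow> True
     | LFalse \<Rightarrow> False
     | LLit l \<Rightarrow> l \<in> I
     | LOr \<Rightarrow> (\<exists>m\<in>children C n. sat m)
     | LAnd \<Rightarrow> (\<forall>m\<in>children C n. sat m))"

definition node_eval ::
  "('n, 'v) nnf \<Rightarrow> ('v literal \<Rightarrow> 'a::{comm_semiring_0, comm_monoid_mult}) \<Rightarrow> 'n \<Rightarrow> 'a"
where
  "node_eval C \<alpha> = wfrec ((edges C)\<inverse>) (\<lambda>ev n.
     case label C n of
       LTrue \<Rightarrow> 1
     | LFalse \<Rightarrow> 0
     | LLit l \<Rightarrow> \<alpha> l
     | LOr \<Rightarrow> (\<Sum>m\<in>children C n. ev m)
     | LAnd \<Rightarrow> (\<Prod>m\<in>children C n. ev m))"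

definition Eval ::
  "('n, 'v) nnf \<Rightarrow> ('v literal \<Rightarrow> 'a::{comm_semiring_0, comm_monoid_mult}) \<Rightarrow> 'a"
where
  "Eval C \<alpha> = node_eval C \<alpha> (root C)"

lemma nnf_circuit_wf:
  assumes "nnf_circuit V C"
  shows "wf ((edges C)\<inverse>)"
proof -
  have "finite (edges C)"
    using assms unfolding nnf_circuit_def by (meson finite_SigmaI finite_subset)
  then show ?thesis
    using assms unfolding nnf_circuit_def by (simp add: finite_acyclic_wf_converse)
qed

lemma node_sat_rec:
  assumes "nnf_circuit V C"
  shows "node_sat C I n =
    (case label C n of
       LTrue \<Rightarrow> True
     | LFalse \<Rightarrow> False
     | LLit l \<Rightarrow> l \<in> I
     | LOr \<Rightarrow> (\<exists>m\<in>children C n. node_sat C I m)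
     | LAnd \<Rightarrow> (\<forall>m\<in>children C n. node_sat C I m))"
  unfolding node_sat_def
  by (subst wfrec[OF nnf_circuit_wf[OF assms]])
    (auto simp: cut_def children_def split: label.split)

lemma node_eval_rec:
  assumes "nnf_circuit V C"
  shows "node_eval C \<alpha> n =
    (case label C n of
       LTrue \<Rightarrow> 1
     | LFalse \<Rightarrow> 0
     | LLit l \<Rightarrow> \<alpha> l
     | LOr \<Rightarrow> (\<Sum>m\<in>children C n. node_eval C \<alpha> m)
     | LAnd \<Rightarrow> (\<Prod>m\<in>children C n. node_eval C \<alpha> m))"
  unfolding node_eval_def
  by (subst wfrec[OF nnf_circuit_wf[OF assms]])
    (auto simp: cut_def children_def split: label.split intro!: sum.cong prod.cong)

definition represents :: "'v set \<Rightarrow> ('n, 'v) nnf \<Rightarrow> 'v formula set \<Rightarrow> bool" where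
  "represents V C T \<longleftrightarrow>
     (\<forall>I\<in>interpretations V. node_sat C I (root C) \<longleftrightarrow> (\<forall>p\<in>T. satisfies I p))"

definition decomposable :: "('n, 'v) nnf \<Rightarrow> bool" where
  "decomposable C \<longleftrightarrow>
     (\<forall>n\<in>nodes C. label C n = LAnd \<longrightarrow>
       (\<forall>i\<in>children C n. \<forall>j\<in>children C n. i \<noteq> j \<longrightarrow> node_vars C i \<inter> node_vars C j = {}))"

definition deterministic :: "'v set \<Rightarrow> ('n, 'v) nnf \<Rightarrow> bool" where
  "deterministic V C \<longleftrightarrow>
     (\<forall>n\<in>nodes C. label C n = LOr \<longrightarrow>
       (\<forall>i\<in>children C n. \<forall>j\<in>children C n. i \<noteq> j \<longrightarrow>
         \<not> (\<exists>I\<in>interpretations V. node_sat C I i \<and> node_sat C I j)))"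

text \<open>
  Smoothness only compares the children of each disjunction node, so it does not make the root
  mention every variable of \<open>V\<close>. For instance, a single node labelled \<open>LTrue\<close> is smooth, and over
  \<open>V = {v}\<close> it represents the empty theory, but its value is \<open>1\<close> and not
  \<open>\<alpha> (Pos v) + \<alpha> (Neg v)\<close>. Equality with \<open>AMC V \<alpha> T\<close> therefore needs
  \<open>node_vars C (root C) = V\<close> as well.
\<close>

definition smooth :: "('n, 'v) nnf \<Rightarrow> bool" where
  "smooth C \<longleftrightarrow>
     (\<forall>n\<in>nodes C. label C n = LOr \<longrightarrow>
       (\<forall>i\<in>children C n. \<forall>j\<in>children C n. node_vars C i = node_vars C j))"

definition sd_DNNF :: "'v set \<Rightarrow> ('n, 'v) nnf \<Rightarrow> bool" where
  "sd_DNNF V C \<longleftrightarrow> nnf_circuit V C \<and> smooth C \<and> deterministic V C \<and> decomposable C"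

end

theory Submission
  imports Defs
begin

text \<open>
  By induction from the leaves upwards, the value of a node \<open>n\<close> is the weighted count of its models
  over \<open>node_vars N n\<close>, the variables it mentions. At a disjunction, smoothness makes the
  children range over the same interpretations and determinism makes their model sets disjoint. At
  a conjunction, decomposability makes the models of the node the unions of independently
  chosen models of its children, so that distributivity applies.
\<close>

text \<open>This generalizes \<open>AMC\<close> to a variable set and a semantic predicate, so that
  it can be applied to each subcircuit and not only to a theory over \<open>V\<close>.\<close>

definition weighted_count ::
  "('v literal \<Rightarrow> 'a::{comm_semiring_0, comm_monoid_mult}) \<Rightarrow> 'v set \<Rightarrow> ('v literal set \<Rightarrow> bool) \<Rightarrow> 'a"
where
  "weighted_count \<alpha> W P = (\<Sum>I | I \<in> interpretations W \<and> P I. \<Prod>l\<in>I. \<alpha> l)"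

text \<open>The quantifiers range over all sets of literals, not only over interpretations of a
  fixed variable set. This allows \<open>P\<close> to be compared on an interpretation and on its
  restriction to fewer variables.\<close>

definition depends_on :: "'v set \<Rightarrow> ('v literal set \<Rightarrow> bool) \<Rightarrow> bool" where
  "depends_on W P \<longleftrightarrow> (\<forall>I J. I \<inter> literals W = J \<inter> literals W \<longrightarrow> P I = P J)"

section \<open>Interpretations: finiteness, restriction, union and extension\<close>

lemma finite_literals: "finite W \<Longrightarrow> finite (literals W)"
proof (rule finite_subset)
  show "literals W \<subseteq> Pos ` W \<union> Neg ` W"
  proof
    fix l assume "l \<in> literals W"
    then show "l \<in> Pos ` W \<union> Neg ` W"
      by (cases l) (auto simp: literals_def)
  qed
qed simp

lemma finite_interpretations: "finite W \<Longrightarrow> finite (interpretations W)"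
  by (rule finite_subset[of _ "Pow (literals W)"])
    (auto simp: interpretations_def finite_literals)

lemma interpretations_empty: "interpretations {} = {{}}"
  by (auto simp: interpretations_def literals_def)

lemma interpretations_restrict:
  "I \<in> interpretations V \<Longrightarrow> W \<subseteq> V \<Longrightarrow> I \<inter> literals W \<in> interpretations W"
  by (auto simp: interpretations_def literals_def)

lemma interpretations_Un:
  assumes "I \<in> interpretations U" "J \<in> interpretations W" "U \<inter> W = {}"
  shows "I \<union> J \<in> interpretations (U \<union> W)"
proof -
  have "(Pos v \<in> I \<union> J) \<noteq> (Neg v \<in> I \<union> J)" if "v \<in> U \<union> W" for v
  proof (cases "v \<in> U")
    case True
    with assms have "v \<notin> W" by blast
    with assms(2) have "Pos v \<notin> J" "Neg v \<notin> J"
      by (auto simp: interpretations_def literals_def)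
    with True assms(1) show ?thesis by (auto simp: interpretations_def)
  next
    case False
    with assms(1) have "Pos v \<notin> I" "Neg v \<notin> I"
      by (auto simp: interpretations_def literals_def)
    with False that assms(2) show ?thesis by (auto simp: interpretations_def)
  qed
  with assms show ?thesis by (auto simp: interpretations_def literals_def)
qed

text \<open>Determinism speaks only about interpretations of \<open>V\<close>. This lemma transfers
  it to interpretations of the variables of a single node.\<close>

lemma interpretations_extend:
  assumes "I \<in> interpretations W" "W \<subseteq> V"
  obtains J where "J \<in> interpretations V" "J \<inter> literals W = I"
proof
  \<comment> \<open>The choice of values outside \<open>W\<close> is arbitrary; here all these
    variables are made true.\<close>
  have "Pos ` (V - W) \<in> interpretations (V - W)"
    by (auto simp: interpretations_def literals_def)
  then have "I \<union> Pos ` (V - W) \<in> interpretations (W \<union> (V - W))"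
    by (intro interpretations_Un) (use assms in auto)
  then show "I \<union> Pos ` (V - W) \<in> interpretations V"
    using assms(2) by (simp add: Un_absorb1)
  show "(I \<union> Pos ` (V - W)) \<inter> literals W = I"
    using assms(1) by (auto simp: interpretations_def literals_def)
qed

section \<open>Arithmetic of weighted counts\<close>

text \<open>Pairs of models over disjoint variable sets correspond bijectively to their unions, and
  the weight of a union is the product of the two weights. Distributivity turns the product of two
  sums into a sum over pairs.\<close>

lemma weighted_count_Un:
  assumes "finite U" "finite W" "U \<inter> W = {}" "depends_on U P" "depends_on W Q"
  shows "weighted_count \<alpha> (U \<union> W) (\<lambda>I. P I \<and> Q I) = weighted_count \<alpha> U P * weighted_count \<alpha> W Q"
proof -
  let ?A = "{I \<in> interpretations U. P I}" and ?B = "{J \<in> interpretations W. Q J}"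
  let ?C = "{K \<in> interpretations (U \<union> W). P K \<and> Q K}"
  have restr: "(I \<union> J) \<inter> literals U = I" "(I \<union> J) \<inter> literals W = J"
    if "I \<in> interpretations U" "J \<in> interpretations W" for I J
    using that assms(3) by (auto simp: interpretations_def literals_def)
  \<comment> \<open>A set and its own restriction agree on the relevant literals, so
    \<open>depends_on\<close> applies to this pair.\<close>
  have dep: "P I = P (I \<inter> literals U)" "Q I = Q (I \<inter> literals W)" for I
    using assms(4,5) unfolding depends_on_def by (metis Int_assoc Int_absorb)+
  have "weighted_count \<alpha> U P * weighted_count \<alpha> W Q =
      (\<Sum>(I, J)\<in>?A \<times> ?B. (\<Prod>l\<in>I. \<alpha> l) * (\<Prod>l\<in>J. \<alpha> l))"
    by (simp add: weighted_count_def sum_product sum.cartesian_product)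
  also have "\<dots> = (\<Sum>K\<in>?C. \<Prod>l\<in>K. \<alpha> l)"
  \<comment> \<open>Union and the pair of restrictions are mutually inverse; the five goals are the
    two inverse laws, the two membership claims and the equality of weights.\<close>
  proof (rule sum.reindex_bij_witness[where i = "\<lambda>K. (K \<inter> literals U, K \<inter> literals W)"
        and j = "\<lambda>(I, J). I \<union> J"], goal_cases)
    case (1 p)
    then obtain I J where "p = (I, J)" "I \<in> interpretations U" "J \<in> interpretations W"
      by blast
    then show ?case by (simp add: restr)
  next
    case (2 p)
    then obtain I J where "p = (I, J)" "I \<in> interpretations U" "J \<in> interpretations W" "P I" "Q J"
      by blast
    then show ?case
      using dep[of "I \<union> J"] interpretations_Un[OF _ _ assms(3)] by (simp add: restr)
  next
    case (3 K)
    then show ?case by (auto simp: interpretations_def literals_def)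
  next
    case (4 K)
    then show ?case using dep by (auto intro: interpretations_restrict)
  next
    case (5 p)
    then obtain I J where p: "p = (I, J)" "I \<in> interpretations U" "J \<in> interpretations W"
      by auto
    then have "finite I" "finite J" "I \<inter> J = {}"
      using assms(1-3) finite_literals
      by (auto simp: interpretations_def literals_def intro: finite_subset)
    then show ?case by (simp add: p prod.union_disjoint)
  qed
  finally show ?thesis by (simp add: weighted_count_def)
qed

text \<open>Induction on \<open>S\<close> splits off one factor at a time with
  \<open>weighted_count_Un\<close>. For empty \<open>S\<close> both sides are \<open>1\<close>, as
  the empty set of variables has exactly one interpretation, of weight \<open>1\<close>.\<close>

lemma weighted_count_UN:
  assumes "finite S" "\<And>i. i \<in> S \<Longrightarrow> finite (W i)" "\<And>i. i \<in> S \<Longrightarrow> depends_on (W i) (P i)"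
    and "\<And>i j. i \<in> S \<Longrightarrow> j \<in> S \<Longrightarrow> i \<noteq> j \<Longrightarrow> W i \<inter> W j = {}"
  shows "weighted_count \<alpha> (\<Union>i\<in>S. W i) (\<lambda>I. \<forall>i\<in>S. P i I) = (\<Prod>i\<in>S. weighted_count \<alpha> (W i) (P i))"
  using assms
proof (induction S rule: finite_induct)
  case empty
  then show ?case by (simp add: weighted_count_def interpretations_empty)
next
  case (insert x S)
  have "depends_on (\<Union>i\<in>S. W i) (\<lambda>I. \<forall>i\<in>S. P i I)"
    unfolding depends_on_def
  proof (intro allI impI ball_cong refl)
    fix I J i
    assume eq: "I \<inter> literals (\<Union>i\<in>S. W i) = J \<inter> literals (\<Union>i\<in>S. W i)" and "i \<in> S"
    then have "I \<inter> literals (W i) = J \<inter> literals (W i)"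
      by (auto simp: literals_def)
    then show "P i I = P i J"
      using insert.prems(2) \<open>i \<in> S\<close> unfolding depends_on_def by blast
  qed
  moreover have "W x \<inter> (\<Union>i\<in>S. W i) = {}"
    using insert.prems(3) insert.hyps by blast
  ultimately have "weighted_count \<alpha> (W x \<union> (\<Union>i\<in>S. W i)) (\<lambda>I. P x I \<and> (\<forall>i\<in>S. P i I)) =
      weighted_count \<alpha> (W x) (P x) * weighted_count \<alpha> (\<Union>i\<in>S. W i) (\<lambda>I. \<forall>i\<in>S. P i I)"
    using insert.prems insert.hyps by (intro weighted_count_Un) auto
  with insert show ?case by simp
qed

text \<open>Mutual exclusion makes the model sets of the \<open>P i\<close> disjoint, so the sum
  over their union splits.\<close>

lemma weighted_count_Ex:
  assumes "finite S" "finite W"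
    and "\<And>i j I. i \<in> S \<Longrightarrow> j \<in> S \<Longrightarrow> i \<noteq> j \<Longrightarrow> I \<in> interpretations W \<Longrightarrow> \<not> (P i I \<and> P j I)"
  shows "weighted_count \<alpha> W (\<lambda>I. \<exists>i\<in>S. P i I) = (\<Sum>i\<in>S. weighted_count \<alpha> W (P i))"
proof -
  have "{I. I \<in> interpretations W \<and> (\<exists>i\<in>S. P i I)} = (\<Union>i\<in>S. {I \<in> interpretations W. P i I})"
    by auto
  moreover have "(\<Sum>I\<in>(\<Union>i\<in>S. {I \<in> interpretations W. P i I}). \<Prod>l\<in>I. \<alpha> l) =
      (\<Sum>i\<in>S. \<Sum>I | I \<in> interpretations W \<and> P i I. \<Prod>l\<in>I. \<alpha> l)"
  proof (rule sum.UNION_disjoint)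
    show "\<forall>i\<in>S. finite {I \<in> interpretations W. P i I}"
      using assms(2) by (simp add: finite_interpretations)
    show "\<forall>i\<in>S. \<forall>j\<in>S. i \<noteq> j \<longrightarrow>
        {I \<in> interpretations W. P i I} \<inter> {I \<in> interpretations W. P j I} = {}"
      using assms(3) by blast
  qed (fact assms(1))
  ultimately show ?thesis
    by (simp add: weighted_count_def)
qed

lemma weighted_count_literal:
  "weighted_count \<alpha> {var_of l} (\<lambda>I. l \<in> I) = \<alpha> l"
proof -
  have "{I. I \<in> interpretations {var_of l} \<and> l \<in> I} = {{l}}"
  proof (intro equalityI subsetI)
    fix I assume I: "I \<in> {I. I \<in> interpretations {var_of l} \<and> l \<in> I}"
    have "l' = l" if "l' \<in> I" for l'
      using I that by (cases l; cases l') (auto simp: interpretations_def literals_def)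
    with I show "I \<in> {{l}}" by blast
  next
    fix I assume "I \<in> {{l}}"
    then show "I \<in> {I. I \<in> interpretations {var_of l} \<and> l \<in> I}"
      by (cases l) (auto simp: interpretations_def literals_def)
  qed
  then show ?thesis by (simp add: weighted_count_def)
qed

text \<open>Splitting off the first edge of a path turns the definition by reachability into a
  recursion over children.\<close>

lemma node_vars_rec:
  "node_vars C n = {var_of l | l. label C n = LLit l} \<union> (\<Union>m\<in>children C n. node_vars C m)"
proof -
  have "(n, k) \<in> (edges C)\<^sup>* \<longleftrightarrow> k = n \<or> (\<exists>m\<in>children C n. (m, k) \<in> (edges C)\<^sup>*)" for k
    unfolding children_def
    by (metis Image_singleton_iff converse_rtranclE converse_rtrancl_into_rtrancl rtrancl.rtrancl_refl)
  then show ?thesis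
    unfolding node_vars_def by (simp only: set_eq_iff mem_Collect_eq Un_iff UN_iff) metis
qed

lemma children_in_nodes: "nnf_circuit V C \<Longrightarrow> children C n \<subseteq> nodes C"
  by (auto simp: nnf_circuit_def children_def)

lemma finite_children: "nnf_circuit V C \<Longrightarrow> finite (children C n)"
  using children_in_nodes[of V C n] finite_subset by (auto simp: nnf_circuit_def)

lemma nnf_circuit_cases [consumes 2, case_names LTrue LFalse LLit LOr LAnd]:
  assumes "nnf_circuit V C" "n \<in> nodes C"
  obtains "label C n = LTrue" "children C n = {}"
  | "label C n = LFalse" "children C n = {}"
  | l where "label C n = LLit l" "children C n = {}" "l \<in> literals V"
  | "label C n = LOr" "children C n \<noteq> {}"
  | "label C n = LAnd" "children C n \<noteq> {}"
proof -
  have "children C n = {} \<Longrightarrow> label C n \<in> {LTrue, LFalse} \<union> LLit ` literals V"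
    and "children C n \<noteq> {} \<Longrightarrow> label C n \<in> {LOr, LAnd}"
    using assms by (simp_all add: nnf_circuit_def)
  then show ?thesis
    using that by (cases "children C n = {}") auto
qed

text \<open>Finiteness and acyclicity make the converse edge relation well-founded, so a property
  may be assumed for the children when it is proved for their parent.\<close>

lemma nnf_circuit_induct [consumes 2, case_names node]:
  assumes "nnf_circuit V C" "n \<in> nodes C"
    and step: "\<And>n. n \<in> nodes C \<Longrightarrow> (\<And>m. m \<in> children C n \<Longrightarrow> P m) \<Longrightarrow> P n"
  shows "P n"
  using nnf_circuit_wf[OF assms(1)] assms(2)
proof (induction n rule: wf_induct_rule)
  case (less n)
  then show ?case
    using children_in_nodes[OF assms(1), of n] by (intro step[of n]) (auto simp: children_def)
qed

lemma node_vars_subset: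
  assumes "nnf_circuit V C" "n \<in> nodes C"
  shows "node_vars C n \<subseteq> V"
  using assms
proof (induction n rule: nnf_circuit_induct)
  case (node n)
  from assms(1) node.hyps show ?case
    by (cases rule: nnf_circuit_cases)
      (use node.IH in \<open>auto simp: node_vars_rec[of C n] literals_def\<close>)
qed

text \<open>The truth value of a node is computed from its own literal or from its children, and all
  literals involved have variables in \<open>node_vars C n\<close>.\<close>

lemma depends_on_node_sat:
  assumes "nnf_circuit V C" "n \<in> nodes C"
  shows "depends_on (node_vars C n) (\<lambda>I. node_sat C I n)"
  using assms
proof (induction n rule: nnf_circuit_induct)
  case (node n)
  show ?case
    unfolding depends_on_def
  proof (intro allI impI)
    fix I J
    assume eq: "I \<inter> literals (node_vars C n) = J \<inter> literals (node_vars C n)"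
    have "node_sat C I m = node_sat C J m" if "m \<in> children C n" for m
    proof -
      have "node_vars C m \<subseteq> node_vars C n"
        using that by (auto simp: node_vars_rec[of C n])
      with eq have "I \<inter> literals (node_vars C m) = J \<inter> literals (node_vars C m)"
        by (auto simp: literals_def)
      with node.IH[OF that] show ?thesis unfolding depends_on_def by blast
    qed
    moreover have "l \<in> I \<longleftrightarrow> l \<in> J" if "label C n = LLit l" for l
    proof -
      have "l \<in> literals (node_vars C n)"
        using that by (subst node_vars_rec) (auto simp: literals_def)
      with eq show ?thesis by blast
    qed
    ultimately show "node_sat C I n = node_sat C J n"
      by (simp add: node_sat_rec[OF assms(1), of _ n] split: label.split)
  qed
qed

text \<open>Counting over \<open>node_vars C n\<close> instead of \<open>V\<close> gives the
  children of a conjunction disjoint variable sets, as \<open>weighted_count_UN\<close>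
  requires.\<close>

lemma node_eval_eq_weighted_count:
  assumes "finite V" "sd_DNNF V C" "n \<in> nodes C"
  shows "node_eval C \<alpha> n = weighted_count \<alpha> (node_vars C n) (\<lambda>I. node_sat C I n)"
proof -
  have C: "nnf_circuit V C" and "smooth C" "deterministic V C" "decomposable C"
    using assms(2) by (auto simp: sd_DNNF_def)
  from C assms(3) show ?thesis
  proof (induction n rule: nnf_circuit_induct)
    case (node n)
    note sat = node_sat_rec[OF C, of _ n] and ev = node_eval_rec[OF C, of \<alpha> n]
      and vars = node_vars_rec[of C n]
    have ch: "m \<in> nodes C" if "m \<in> children C n" for m
      using children_in_nodes[OF C] that by blast
    have fin: "finite (node_vars C m)" if "m \<in> nodes C" for m
      using node_vars_subset[OF C that] assms(1) by (rule finite_subset)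
    from C node.hyps show ?case
    proof (cases rule: nnf_circuit_cases)
      case LTrue
      \<comment> \<open>The node mentions no variable, so the count has the single summand for the
        empty interpretation, an empty product.\<close>
      then show ?thesis
        by (simp add: sat ev vars weighted_count_def interpretations_empty)
    next
      case LFalse
      then show ?thesis
        by (simp add: sat ev vars weighted_count_def)
    next
      case (LLit l)
      then show ?thesis
        by (simp add: sat ev vars weighted_count_literal)
    next
      case LOr
      \<comment> \<open>By smoothness, the union of the children's variable sets collapses to the
        set of any one child.\<close>
      have same: "node_vars C m = node_vars C n" if "m \<in> children C n" for m
      proof -
        have "node_vars C n = (\<Union>k\<in>children C n. node_vars C k)"
          using LOr by (simp add: vars)
        also have "\<dots> = (\<Union>k\<in>children C n. node_vars C m)"
          using \<open>smooth C\<close> node.hyps LOr that unfolding smooth_def by (intro SUP_cong refl) blast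
        also have "\<dots> = node_vars C m"
          using that by blast
        finally show ?thesis ..
      qed
      have "\<not> (node_sat C I i \<and> node_sat C I j)"
        if I: "i \<in> children C n" "j \<in> children C n" "i \<noteq> j" "I \<in> interpretations (node_vars C n)"
        for i j I
      proof -
        \<comment> \<open>Extending \<open>I\<close> to all of \<open>V\<close> keeps the truth
          values of both children, and determinism then applies to \<open>J\<close>.\<close>
        obtain J where J: "J \<in> interpretations V" "J \<inter> literals (node_vars C n) = I"
          using interpretations_extend[OF I(4) node_vars_subset[OF C node.hyps]] .
        then have "I \<inter> literals (node_vars C n) = J \<inter> literals (node_vars C n)"
          by blast
        then have "node_sat C I i = node_sat C J i" "node_sat C I j = node_sat C J j"
          using depends_on_node_sat[OF C ch] I(1,2) same unfolding depends_on_def by metis+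
        then show ?thesis
          using \<open>deterministic V C\<close> node.hyps LOr J(1) I unfolding deterministic_def by blast
      qed
      then have "weighted_count \<alpha> (node_vars C n) (\<lambda>I. \<exists>m\<in>children C n. node_sat C I m) =
          (\<Sum>m\<in>children C n. weighted_count \<alpha> (node_vars C n) (\<lambda>I. node_sat C I m))"
        by (intro weighted_count_Ex finite_children[OF C] fin node.hyps)
      then show ?thesis
        using LOr node.IH same by (simp add: sat ev)
    next
      case LAnd
      have "weighted_count \<alpha> (\<Union>m\<in>children C n. node_vars C m)
          (\<lambda>I. \<forall>m\<in>children C n. node_sat C I m) =
          (\<Prod>m\<in>children C n. weighted_count \<alpha> (node_vars C m) (\<lambda>I. node_sat C I m))"
        using \<open>decomposable C\<close> node.hyps LAnd unfolding decomposable_def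
        by (intro weighted_count_UN finite_children[OF C] fin depends_on_node_sat[OF C] ch) auto
      then show ?thesis
        using LAnd node.IH by (simp add: sat ev vars)
    qed
  qed
qed

theorem theorem2:
  fixes V :: "'v set"
    and T :: "'v formula set"
    and \<alpha> :: "'v literal \<Rightarrow> 'a::{comm_semiring_0, comm_monoid_mult}"
    and N :: "('n, 'v) nnf"
  assumes "finite V"
    and "theory_over V T"
    and "sd_DNNF V N"
    and "represents V N T"
    and "node_vars N (root N) = V"
  shows "Eval N \<alpha> = AMC V \<alpha> T"
proof -
  have "root N \<in> nodes N"
    using assms(3) by (simp add: sd_DNNF_def nnf_circuit_def)
  \<comment> \<open>The induction yields a count over the variables of the root; the assumption that
    these are all of \<open>V\<close> makes it a count over \<open>V\<close>.\<close>
  then have "Eval N \<alpha> = weighted_count \<alpha> V (\<lambda>I. node_sat N I (root N))"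
    using assms(5) by (simp add: Eval_def node_eval_eq_weighted_count[OF assms(1,3)])
  moreover have "{I. I \<in> interpretations V \<and> node_sat N I (root N)} = models V T"
    using assms(4) by (auto simp: represents_def models_def)
  ultimately show ?thesis
    by (simp add: weighted_count_def AMC_def)
qed

end
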